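(* Let $\mathbb F$ be a division ring with center $Z_{\mathbb F}$, and let $\Delta_\ell,\Delta_r\subset\mathbb F$ be algebraic sets such that every element of $\Delta_\ell$ is algebraic over $Z_{\mathbb F}$. Then the pair $(\Delta_\ell,\Delta_r)$ is $P$-independent if and only if $\Delta_\ell$ is left $P$-independent, $\Delta_r$ is right $P$-independent, and $[\Delta_\ell]\cap[\Delta_r]=\varnothing$.
   Context: $\mathbb F[z]$ is the ring of polynomials in a variable $z$ commuting with the coefficients from $\mathbb F$; $P_N(\mathbb F)=\{g\in\mathbb F[z]:\deg g<N\}$ (including $0$; all of $\mathbb F[z]$ if $N$ is infinite). For $f(z)=\sum_j z^jf_j$, the left and right values are $f^{\mathfrak e_\ell}(\alpha)=\sum_j\alpha^jf_j$ and $f^{\mathfrak e_r}(\alpha)=\sum_j f_j\alpha^j$. A set is algebraic if some nonzero polynomial vanishes on it (under left evaluation for $\Delta_\ell$, right evaluation for $\Delta_r$). For such sets, $P_{\Delta_\ell,\ell}$ is the monic generator of the right ideal $\{f: f^{\mathfrak e_\ell}|_{\Delta_\ell}=0\}$ and $P_{\Delta_r,r}$ is the monic generator of the left ideal $\{f: f^{\mathfrak e_r}|_{\Delta_r}=0\}$. $\Delta_\ell$ is left $P$-independent if $\deg P_{\Delta_\ell,\ell}=|\Delta_\ell|$; $\Delta_r$ is right $P$-independent if $\deg P_{\Delta_r,r}=|\Delta_r|$. The pair $(\Delta_\ell,\Delta_r)$ is $P$-independent if there is no nonzero $g\in P_{|\Delta_\ell|+|\Delta_r|}(\mathbb F)$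 such that $g^{\mathfrak e_\ell}|_{\Delta_\ell}=0$ and $g^{\mathfrak e_r}|_{\Delta_r}=0$. $[\alpha]=\{h\alpha h^{-1}:h\in\mathbb F\setminus\{0\}\}$ and $[\Delta]=\bigcup_{\alpha\in\Delta}[\alpha]$. *)

theory Defs
  imports "HOL-Library.Poly_Mapping" "HOL-Library.Extended_Nat"
begin

text \<open>
  The type \<open>'a poly\<close> has a multiplication only over commutative coefficients.  For a
  division ring we use the monoid algebra of \<open>nat\<close>: its convolution product
  \<open>(f * g)\<^sub>k = (\<Sum>i + j = k. f\<^sub>i * g\<^sub>j)\<close> is the product for which the variable commutes with
  the coefficients.
\<close>

type_synonym 'a ncpoly = "nat \<Rightarrow>\<^sub>0 'a"

text \<open>The zero polynomial gets degree 0; where this matters it is treated separately.\<close>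

definition ncdeg :: "'a::zero ncpoly \<Rightarrow> nat"
  where "ncdeg f = Max (insert 0 (Poly_Mapping.keys f))"

definition monic :: "'a::zero_neq_one ncpoly \<Rightarrow> bool"
  where "monic f \<longleftrightarrow> Poly_Mapping.lookup f (ncdeg f) = 1"

definition polys_below :: "enat \<Rightarrow> 'a::zero ncpoly set"
  where "polys_below N = {g. g = 0 \<or> enat (ncdeg g) < N}"

definition left_value :: "'a::semiring_1 ncpoly \<Rightarrow> 'a \<Rightarrow> 'a"
  where "left_value f \<alpha> = (\<Sum>j\<in>Poly_Mapping.keys f. \<alpha> ^ j * Poly_Mapping.lookup f j)"

definition right_value :: "'a::semiring_1 ncpoly \<Rightarrow> 'a \<Rightarrow> 'a"
  where "right_value f \<alpha> = (\<Sum>j\<in>Poly_Mapping.keys f. Poly_Mapping.lookup f j * \<alpha> ^ j)"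

definition left_annihilator :: "'a::semiring_1 set \<Rightarrow> 'a ncpoly set"
  where "left_annihilator \<Delta> = {f. \<forall>\<alpha>\<in>\<Delta>. left_value f \<alpha> = 0}"

definition right_annihilator :: "'a::semiring_1 set \<Rightarrow> 'a ncpoly set"
  where "right_annihilator \<Delta> = {f. \<forall>\<alpha>\<in>\<Delta>. right_value f \<alpha> = 0}"

definition left_algebraic_set :: "'a::division_ring set \<Rightarrow> bool"
  where "left_algebraic_set \<Delta> \<longleftrightarrow> (\<exists>f \<in> left_annihilator \<Delta>. f \<noteq> 0)"

definition right_algebraic_set :: "'a::division_ring set \<Rightarrow> bool"
  where "right_algebraic_set \<Delta> \<longleftrightarrow> (\<exists>f \<in> right_annihilator \<Delta>. f \<noteq> 0)"

text \<open>
  The sets vanishing under left evaluation are right ideals, so they are generated by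
  multiplying \<open>P\<close> with polynomials on the right; symmetrically for right evaluation.  The
  descriptions below are meaningful only for algebraic sets: otherwise the ideal is zero and
  has no monic generator.
\<close>

definition left_min_poly :: "'a::division_ring set \<Rightarrow> 'a ncpoly"
  where "left_min_poly \<Delta> =
    (THE P. monic P \<and> left_annihilator \<Delta> = {P * q | q. True})"

definition right_min_poly :: "'a::division_ring set \<Rightarrow> 'a ncpoly"
  where "right_min_poly \<Delta> =
    (THE P. monic P \<and> right_annihilator \<Delta> = {q * P | q. True})"

text \<open>Unlike \<open>card\<close>, which is 0 on infinite sets:\<close>

definition set_size :: "'b set \<Rightarrow> enat"
  where "set_size A = (if finite A then enat (card A) else \<infinity>)"

definition left_P_independent :: "'a::division_ring set \<Rightarrow> bool"
  where "left_P_independent \<Delta> \<longleftrightarrow>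
    left_algebraic_set \<Delta> \<and> enat (ncdeg (left_min_poly \<Delta>)) = set_size \<Delta>"

definition right_P_independent :: "'a::division_ring set \<Rightarrow> bool"
  where "right_P_independent \<Delta> \<longleftrightarrow>
    right_algebraic_set \<Delta> \<and> enat (ncdeg (right_min_poly \<Delta>)) = set_size \<Delta>"

definition pair_P_independent :: "'a::division_ring set \<Rightarrow> 'a set \<Rightarrow> bool"
  where "pair_P_independent \<Delta>l \<Delta>r \<longleftrightarrow>
    \<not> (\<exists>g \<in> polys_below (set_size \<Delta>l + set_size \<Delta>r). g \<noteq> 0 \<and>
        (\<forall>\<alpha>\<in>\<Delta>l. left_value g \<alpha> = 0) \<and> (\<forall>\<beta>\<in>\<Delta>r. right_value g \<beta> = 0))"

definition center :: "'a::division_ring set"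
  where "center = {c. \<forall>x. c * x = x * c}"

text \<open>The two evaluations agree on polynomials with central coefficients.\<close>

definition algebraic_over_center :: "'a::division_ring \<Rightarrow> bool"
  where "algebraic_over_center \<alpha> \<longleftrightarrow>
    (\<exists>f. f \<noteq> 0 \<and> (\<forall>j. Poly_Mapping.lookup f j \<in> center) \<and> left_value f \<alpha> = 0)"

definition conj_class :: "'a::division_ring \<Rightarrow> 'a set"
  where "conj_class \<alpha> = {h * \<alpha> * inverse h | h. h \<noteq> 0}"

definition conj_closure :: "'a::division_ring set \<Rightarrow> 'a set"
  where "conj_closure \<Delta> = (\<Union>\<alpha>\<in>\<Delta>. conj_class \<alpha>)"

end

theory Submission
  imports Defs
begin

text \<open>
  The whole argument rests on twisted values.  For \<open>h\<close> in the division ring put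
  \<open>right_eval f h \<beta> = (\<Sum>j. f\<^sub>j * h * \<beta>^j)\<close>; for \<open>h \<noteq> 0\<close> this is the right value of \<open>f\<close> at
  the conjugate \<open>h * \<beta> * inverse h\<close>, multiplied by \<open>h\<close>.  So \<open>f\<close> has a right root in the
  conjugacy class of \<open>\<beta>\<close> exactly if \<open>\<lambda>h. right_eval f h \<beta>\<close> has a nontrivial kernel, and
  these maps are additive and turn products of polynomials into compositions
  (\<open>right_eval_mult\<close>).

  For a finite set \<open>\<Delta>\<close> the generator \<open>W\<close> of the left annihilator is built by appending
  linear factors \<open>z - \<alpha>'\<close> with \<open>\<alpha>'\<close> conjugate to an element of \<open>\<Delta>\<close>.  Hence its degree is
  at most \<open>card \<Delta>\<close>, and its right roots lie in the conjugacy classes of \<open>\<Delta>\<close>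
  (\<open>left_annihilator_generator\<close>).  Independence of \<open>\<Delta>\<close> thus means that no nonzero polynomial
  of degree below \<open>card \<Delta>\<close> vanishes on \<open>\<Delta>\<close> (\<open>left_P_independent_iff\<close>).  The statements for
  right evaluation are the same statements over the opposite division ring.

  If the conjugacy closures are disjoint and both sets are independent, take \<open>g\<close> that
  vanishes on both sides and write \<open>g = W * q\<close>.  Because \<open>W\<close> has no right root conjugate to
  an element of \<open>\<Delta>r\<close>, already \<open>q\<close> vanishes on \<open>\<Delta>r\<close>, and the degrees of \<open>W\<close> and \<open>q\<close> add
  up to at least \<open>card \<Delta>l + card \<Delta>r\<close> (\<open>pair_P_independent_if_disjoint\<close>).

  Conversely, the product of a polynomial vanishing on \<open>\<Delta>l\<close> with one vanishing on \<open>\<Delta>r\<close>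
  vanishes on both sides.  So an independent pair has finite and independent components.  If
  \<open>\<alpha>\<close> in \<open>\<Delta>l\<close> and \<open>\<beta>\<close> in \<open>\<Delta>r\<close> were conjugate, one degree could be saved: with \<open>W\<close> as above
  and \<open>V\<close> the right generator for \<open>\<Delta>r\<close> without \<open>\<beta>\<close>, some product \<open>W * c * V\<close> with a
  constant \<open>c \<noteq> 0\<close> would vanish at \<open>\<beta>\<close> as well
  (\<open>conjugate_imp_not_pair_P_independent\<close>).  Such a \<open>c\<close> exists because \<open>W\<close>, having the left
  root \<open>\<alpha>\<close>, also has a right root in the class of \<open>\<alpha>\<close>.  This passage from left to right roots
  is where algebraicity of \<open>\<alpha>\<close> over the center enters (\<open>left_root_imp_right_root\<close>).
\<close>

section \<open>Degrees and division with remainder\<close>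

lemma ncpoly_induct [case_names single add]:
  fixes f :: "'a::comm_monoid_add ncpoly"
  assumes single: "\<And>j c. P (Poly_Mapping.single j c)"
    and add: "\<And>f g. P f \<Longrightarrow> P g \<Longrightarrow> P (f + g)"
  shows "P f"
proof -
  have "P (\<Sum>j\<in>A. Poly_Mapping.single j (Poly_Mapping.lookup f j))" if "finite A" for A
    using that
  proof (induction A rule: finite_induct)
    case empty
    show ?case using single[of 0 0] by simp
  next
    case (insert x F)
    then show ?case by (simp add: add single)
  qed
  moreover have "(\<Sum>j\<in>Poly_Mapping.keys f. Poly_Mapping.single j (Poly_Mapping.lookup f j)) = f"
  proof (rule poly_mapping_eqI)
    fix k
    have "Poly_Mapping.lookup (\<Sum>j\<in>Poly_Mapping.keys f. Poly_Mapping.single j (Poly_Mapping.lookup f j)) k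
        = (\<Sum>j\<in>Poly_Mapping.keys f. if j = k then Poly_Mapping.lookup f j else 0)"
      by (simp add: lookup_sum lookup_single when_def)
    also have "\<dots> = Poly_Mapping.lookup f k"
      by (simp add: in_keys_iff)
    finally show "Poly_Mapping.lookup (\<Sum>j\<in>Poly_Mapping.keys f. Poly_Mapping.single j (Poly_Mapping.lookup f j)) k = Poly_Mapping.lookup f k" .
  qed
  ultimately show ?thesis by (metis finite_keys)
qed

lemma ncdeg_le_iff: "ncdeg f \<le> n \<longleftrightarrow> (\<forall>j>n. Poly_Mapping.lookup f j = 0)"
  by (simp add: ncdeg_def Ball_def in_keys_iff) (metis not_le)

lemma ncdeg_zero [simp]: "ncdeg 0 = 0"
  by (simp add: ncdeg_def)

lemma lookup_ncdeg_neq_0: "f \<noteq> 0 \<Longrightarrow> Poly_Mapping.lookup f (ncdeg f) \<noteq> 0"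
proof -
  assume "f \<noteq> 0"
  then have ne: "Poly_Mapping.keys f \<noteq> {}"
    by (metis ex_in_conv in_keys_iff lookup_zero poly_mapping_eqI)
  then have "ncdeg f = Max (Poly_Mapping.keys f)"
    by (simp add: ncdeg_def)
  with ne have "ncdeg f \<in> Poly_Mapping.keys f" by simp
  then show ?thesis by (simp add: in_keys_iff)
qed

lemma ncdeg_minus_less:
  fixes f g :: "'a::ring_1 ncpoly"
  assumes "ncdeg f \<le> n" "ncdeg g \<le> n" "Poly_Mapping.lookup f n = Poly_Mapping.lookup g n" "f \<noteq> g"
  shows "ncdeg (f - g) < n"
proof -
  have le: "ncdeg (f - g) \<le> n"
    using assms(1,2) by (simp add: ncdeg_le_iff lookup_minus)
  moreover have "Poly_Mapping.lookup (f - g) n = 0"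
    using assms(3) by (simp add: lookup_minus)
  ultimately show ?thesis
    using lookup_ncdeg_neq_0[of "f - g"] assms(4) by (metis eq_iff_diff_eq_0 le_neq_implies_less)
qed

lemma lookup_mult_bounded:
  fixes f g :: "'a::semiring_0 ncpoly"
  assumes "ncdeg f \<le> m" "ncdeg g \<le> n"
  shows "Poly_Mapping.lookup (f * g) (m + n) = Poly_Mapping.lookup f m * Poly_Mapping.lookup g n"
proof -
  have "Poly_Mapping.lookup f l * (\<Sum>q. Poly_Mapping.lookup g q when m + n = l + q)
      = (Poly_Mapping.lookup f m * Poly_Mapping.lookup g n when l = m)" for l
  proof (cases l m rule: linorder_cases)
    case less
    then have "(Poly_Mapping.lookup g q when m + n = l + q) = 0" for q
      using assms(2) by (auto simp: when_def ncdeg_le_iff)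
    then show ?thesis using less by simp
  next
    case equal
    have "(\<lambda>q. Poly_Mapping.lookup g q when n = q) = (\<lambda>q. Poly_Mapping.lookup g q when q = n)"
      by (auto simp: when_def)
    then show ?thesis using equal by simp
  next
    case greater
    then show ?thesis using assms(1) by (simp add: ncdeg_le_iff)
  qed
  then show ?thesis by (simp add: lookup_mult)
qed

lemma ncdeg_mult_le:
  fixes f g :: "'a::semiring_0 ncpoly"
  shows "ncdeg (f * g) \<le> ncdeg f + ncdeg g"
proof -
  have "Poly_Mapping.lookup (f * g) j = 0" if "j > ncdeg f + ncdeg g" for j
  proof (rule ccontr)
    assume "Poly_Mapping.lookup (f * g) j \<noteq> 0"
    then have "j \<in> Poly_Mapping.keys (f * g)" by (simp add: in_keys_iff)
    then obtain a b where "j = a + b" "a \<in> Poly_Mapping.keys f" "b \<in> Poly_Mapping.keys g"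
      using keys_mult[of f g] by auto
    moreover from this have "a \<le> ncdeg f" "b \<le> ncdeg g"
      by (simp_all add: ncdeg_def)
    ultimately show False using that by simp
  qed
  then show ?thesis by (simp add: ncdeg_le_iff)
qed

lemma lookup_mult_ncdeg:
  fixes f g :: "'a::semiring_0 ncpoly"
  shows "Poly_Mapping.lookup (f * g) (ncdeg f + ncdeg g) = Poly_Mapping.lookup f (ncdeg f) * Poly_Mapping.lookup g (ncdeg g)"
  by (rule lookup_mult_bounded) simp_all

lemma ncdeg_mult:
  fixes f g :: "'a::ring_1_no_zero_divisors ncpoly"
  assumes "f \<noteq> 0" "g \<noteq> 0"
  shows "ncdeg (f * g) = ncdeg f + ncdeg g"
proof (rule antisym[OF ncdeg_mult_le])
  have "Poly_Mapping.lookup (f * g) (ncdeg f + ncdeg g) \<noteq> 0"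
    using assms by (simp add: lookup_mult_ncdeg lookup_ncdeg_neq_0)
  then show "ncdeg f + ncdeg g \<le> ncdeg (f * g)"
    using ncdeg_le_iff[of "f * g" "ncdeg (f * g)"] by (metis le_refl not_le)
qed

lemma monic_nonzero: "monic f \<Longrightarrow> f \<noteq> (0 :: 'a::zero_neq_one ncpoly)"
  by (auto simp: monic_def)

lemma ncdeg_single: "c \<noteq> 0 \<Longrightarrow> ncdeg (Poly_Mapping.single n c) = n"
  by (simp add: ncdeg_def)

lemma lookup_const_mult:
  fixes f :: "'a::semiring_0 ncpoly"
  shows "Poly_Mapping.lookup (Poly_Mapping.single 0 c * f) j = c * Poly_Mapping.lookup f j"
  by (induction f rule: ncpoly_induct)
    (simp_all add: mult_single lookup_single distrib_left lookup_add when_def)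

lemma lookup_mult_const:
  fixes f :: "'a::semiring_0 ncpoly"
  shows "Poly_Mapping.lookup (f * Poly_Mapping.single 0 c) j = Poly_Mapping.lookup f j * c"
  by (induction f rule: ncpoly_induct)
    (simp_all add: mult_single lookup_single distrib_right lookup_add when_def)

lemma left_division:
  fixes p q :: "'a::division_ring ncpoly"
  assumes "q \<noteq> 0"
  shows "\<exists>s r. p = q * s + r \<and> (r = 0 \<or> ncdeg r < ncdeg q)"
proof (induction "ncdeg p" arbitrary: p rule: less_induct)
  case less
  show ?case
  proof (cases "p = 0 \<or> ncdeg p < ncdeg q")
    case True
    then show ?thesis by (intro exI[of _ 0] exI[of _ p]) simp
  next
    case False
    define c where "c = inverse (Poly_Mapping.lookup q (ncdeg q)) * Poly_Mapping.lookup p (ncdeg p)"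
    define t where "t = Poly_Mapping.single (ncdeg p - ncdeg q) c"
    have c: "c \<noteq> 0"
      using False assms by (simp add: c_def lookup_ncdeg_neq_0 nonzero_imp_inverse_nonzero)
    then have t: "t \<noteq> 0" "ncdeg t = ncdeg p - ncdeg q"
      by (auto simp: t_def ncdeg_single) (metis lookup_single_eq lookup_zero)
    have deg: "ncdeg (q * t) = ncdeg p"
      using t assms False by (simp add: ncdeg_mult)
    have "Poly_Mapping.lookup (q * t) (ncdeg p) = Poly_Mapping.lookup q (ncdeg q) * c"
      using lookup_mult_ncdeg[of q t] t False by (simp add: t_def)
    also have "\<dots> = Poly_Mapping.lookup p (ncdeg p)"
      using assms by (simp add: c_def lookup_ncdeg_neq_0 mult.assoc[symmetric])
    finally have lead: "Poly_Mapping.lookup p (ncdeg p) = Poly_Mapping.lookup (q * t) (ncdeg p)" by simp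
    show ?thesis
    proof (cases "p = q * t")
      case True
      then show ?thesis by (intro exI[of _ t] exI[of _ 0]) simp
    next
      case False
      then have "ncdeg (p - q * t) < ncdeg p"
        by (intro ncdeg_minus_less) (simp_all add: deg lead)
      from less[OF this] obtain s r where
        "p - q * t = q * s + r" "r = 0 \<or> ncdeg r < ncdeg q" by blast
      then show ?thesis
        by (intro exI[of _ "t + s"] exI[of _ r]) (auto simp: algebra_simps)
    qed
  qed
qed

text \<open>
  Euclid's algorithm shows that any two nonzero polynomials have a common right multiple whose
  degree is at most the sum of their degrees; the bound on \<open>g\<close> expresses this.
\<close>

lemma common_right_multiple:
  fixes p q :: "'a::division_ring ncpoly"
  assumes "p \<noteq> 0" "q \<noteq> 0"
  shows "\<exists>g h. g \<noteq> 0 \<and> q * g = p * h \<and> ncdeg g \<le> ncdeg p"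
  using assms
proof (induction "ncdeg q" arbitrary: p q rule: less_induct)
  case less
  obtain s r where sr: "p = q * s + r" "r = 0 \<or> ncdeg r < ncdeg q"
    using left_division[OF less.prems(2)] by blast
  show ?case
  proof (cases "r = 0")
    case True
    with sr less.prems have "s \<noteq> 0" "ncdeg s \<le> ncdeg p" "q * s = p * 1"
      by (auto simp: ncdeg_mult)
    then show ?thesis by blast
  next
    case False
    with sr less.hyps[of r q] less.prems obtain g h where
      gh: "g \<noteq> 0" "r * g = q * h" "ncdeg g \<le> ncdeg q" by blast
    have eq: "q * (s * g + h) = p * g"
      by (simp add: sr(1) algebra_simps gh(2))
    moreover have "p * g \<noteq> 0" using gh less.prems by simp
    ultimately have nz: "s * g + h \<noteq> 0" by auto
    have "ncdeg q + ncdeg (s * g + h) = ncdeg p + ncdeg g"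
      using eq nz gh(1) less.prems by (metis ncdeg_mult)
    with gh(3) have "ncdeg (s * g + h) \<le> ncdeg p" by simp
    with eq nz show ?thesis by blast
  qed
qed

section \<open>Twisted evaluation\<close>

text \<open>
  A product cannot be evaluated factor by factor, since the constant produced by one factor
  does not commute with the point.  Keeping that constant as the argument \<open>h\<close>, between the
  coefficients and the powers, repairs this.
\<close>

definition left_eval :: "'a::semiring_1 ncpoly \<Rightarrow> 'a \<Rightarrow> 'a \<Rightarrow> 'a"
  where "left_eval f h \<alpha> = (\<Sum>j\<in>Poly_Mapping.keys f. \<alpha> ^ j * h * Poly_Mapping.lookup f j)"

definition right_eval :: "'a::semiring_1 ncpoly \<Rightarrow> 'a \<Rightarrow> 'a \<Rightarrow> 'a"
  where "right_eval f h \<beta> = (\<Sum>j\<in>Poly_Mapping.keys f. Poly_Mapping.lookup f j * h * \<beta> ^ j)"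

lemma left_value_eq: "left_value f \<alpha> = left_eval f 1 \<alpha>"
  by (simp add: left_value_def left_eval_def)

lemma right_value_eq: "right_value f \<beta> = right_eval f 1 \<beta>"
  by (simp add: right_value_def right_eval_def)

lemma left_eval_add: "left_eval (f + g) h \<alpha> = left_eval f h \<alpha> + left_eval g h \<alpha>"
  unfolding left_eval_def
  by (rule setsum_keys_plus_distrib) (simp_all add: distrib_left)

lemma right_eval_add: "right_eval (f + g) h \<beta> = right_eval f h \<beta> + right_eval g h \<beta>"
  unfolding right_eval_def
  by (rule setsum_keys_plus_distrib) (simp_all add: distrib_right)

lemma left_eval_single [simp]: "left_eval (Poly_Mapping.single j c) h \<alpha> = \<alpha> ^ j * h * c"
  by (cases "c = 0") (simp_all add: left_eval_def)

lemma right_eval_single [simp]: "right_eval (Poly_Mapping.single j c) h \<beta> = c * h * \<beta> ^ j"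
  by (cases "c = 0") (simp_all add: right_eval_def)

lemma left_eval_zero [simp]: "left_eval 0 h \<alpha> = 0" "left_eval f 0 \<alpha> = 0"
  by (simp_all add: left_eval_def)

lemma right_eval_zero [simp]: "right_eval 0 h \<beta> = 0" "right_eval f 0 \<beta> = 0"
  by (simp_all add: right_eval_def)

lemma left_eval_add_arg: "left_eval f (h + k) \<alpha> = left_eval f h \<alpha> + left_eval f k \<alpha>"
  by (simp add: left_eval_def algebra_simps sum.distrib)

lemma right_eval_add_arg: "right_eval f (h + k) \<beta> = right_eval f h \<beta> + right_eval f k \<beta>"
  by (simp add: right_eval_def algebra_simps sum.distrib)

lemma left_eval_diff:
  fixes f g :: "'a::ring_1 ncpoly"
  shows "left_eval (f - g) h \<alpha> = left_eval f h \<alpha> - left_eval g h \<alpha>"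
  using left_eval_add[of "f - g" g h \<alpha>] by simp

lemma right_eval_diff:
  fixes f g :: "'a::ring_1 ncpoly"
  shows "right_eval (f - g) h \<beta> = right_eval f h \<beta> - right_eval g h \<beta>"
  using right_eval_add[of "f - g" g h \<beta>] by simp

lemma left_eval_mult: "left_eval (f * g) h \<alpha> = left_eval g (left_eval f h \<alpha>) \<alpha>"
proof (induction f rule: ncpoly_induct)
  case (single i a)
  show ?case
  proof (induction g rule: ncpoly_induct)
    case (single j b)
    show ?case
      by (simp only: mult_single left_eval_single add.commute[of i j] power_add mult.assoc)
  qed (simp add: distrib_left left_eval_add)
qed (simp add: distrib_right left_eval_add left_eval_add_arg)

lemma right_eval_mult: "right_eval (f * g) h \<beta> = right_eval f (right_eval g h \<beta>) \<beta>"
proof (induction f rule: ncpoly_induct)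
  case (single i a)
  show ?case
  proof (induction g rule: ncpoly_induct)
    case (single j b)
    show ?case
      by (simp add: mult_single mult.assoc add.commute[of i j] power_add)
  qed (simp add: distrib_left right_eval_add right_eval_add_arg)
qed (simp add: distrib_right right_eval_add)

text \<open>For \<open>u \<noteq> 0\<close> the points \<open>\<alpha>\<close> and \<open>\<beta>\<close> are conjugate, and multiplication by \<open>u\<close> carries
  the kernel of twisted evaluation at \<open>\<beta>\<close> to the one at \<open>\<alpha>\<close>.\<close>

lemma right_eval_conj:
  assumes "\<beta> * u = u * \<alpha>"
  shows "right_eval f h \<beta> * u = right_eval f (h * u) \<alpha>"
proof -
  have "\<beta> ^ j * u = u * \<alpha> ^ j" for j
    by (induction j) (simp_all add: mult.assoc, metis assms mult.assoc power_commutes)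
  then show ?thesis
    by (simp add: right_eval_def sum_distrib_right mult.assoc)
qed

definition linear_factor :: "'a::ring_1 \<Rightarrow> 'a ncpoly"
  where "linear_factor \<alpha> = Poly_Mapping.single 1 1 - Poly_Mapping.single 0 \<alpha>"

lemma left_eval_linear_factor: "left_eval (linear_factor \<alpha>) h \<gamma> = \<gamma> * h - h * \<alpha>"
  by (simp add: linear_factor_def left_eval_diff)

lemma right_eval_linear_factor: "right_eval (linear_factor \<alpha>) h \<gamma> = h * \<gamma> - \<alpha> * h"
  by (simp add: linear_factor_def right_eval_diff)

lemma linear_factor_props:
  "ncdeg (linear_factor \<alpha>) = 1" "monic (linear_factor \<alpha>)"
  "linear_factor \<alpha> \<noteq> (0 :: 'a::ring_1 ncpoly)"
proof -
  have l: "Poly_Mapping.lookup (linear_factor \<alpha>) 1 = 1"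
    by (simp add: linear_factor_def lookup_minus lookup_single)
  then show nz: "linear_factor \<alpha> \<noteq> 0" by (metis lookup_zero zero_neq_one)
  have "ncdeg (linear_factor \<alpha>) \<le> 1"
    by (simp add: linear_factor_def ncdeg_le_iff lookup_minus lookup_single when_def)
  moreover have "1 \<le> ncdeg (linear_factor \<alpha>)"
    using l ncdeg_le_iff[of "linear_factor \<alpha>" 0] by (metis One_nat_def Suc_leI less_one not_le zero_neq_one)
  ultimately show "ncdeg (linear_factor \<alpha>) = 1" by simp
  with l show "monic (linear_factor \<alpha>)" by (simp add: monic_def)
qed

text \<open>
  The case \<open>h = 1\<close> is the usual factor theorem.  For general \<open>h\<close> it applies to a point that
  has been moved within its conjugacy class by the value \<open>h\<close> of a factor to the left of \<open>f\<close>.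
\<close>

lemma left_factor_theorem:
  fixes f :: "'a::division_ring ncpoly"
  assumes "left_eval f h \<gamma> = 0" "h \<noteq> 0" "\<gamma> * h = h * \<alpha>"
  shows "\<exists>q. f = linear_factor \<alpha> * q"
proof -
  obtain q r where qr: "f = linear_factor \<alpha> * q + r"
      "r = 0 \<or> ncdeg r < ncdeg (linear_factor \<alpha>)"
    using left_division[OF linear_factor_props(3)] by blast
  then have "\<forall>j>0. Poly_Mapping.lookup r j = 0"
    by (auto simp: linear_factor_props(1) simp flip: ncdeg_le_iff)
  then have r: "r = Poly_Mapping.single 0 (Poly_Mapping.lookup r 0)"
    by (intro poly_mapping_eqI) (auto simp: lookup_single when_def)
  have "left_eval f h \<gamma> = left_eval r h \<gamma>"
    by (simp add: qr(1) left_eval_add left_eval_mult left_eval_linear_factor assms(3))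
  also have "\<dots> = h * Poly_Mapping.lookup r 0"
    by (subst r) simp
  finally have "Poly_Mapping.lookup r 0 = 0" using assms by simp
  with r have "r = 0" by simp
  with qr show ?thesis by auto
qed

section \<open>Generators of annihilators\<close>

lemma conj_closure_mono: "A \<subseteq> B \<Longrightarrow> conj_closure A \<subseteq> conj_closure B"
  by (auto simp: conj_closure_def)

lemma self_in_right_ideal: "P \<in> {P * q | q. True}" for P :: "'a::monoid_mult"
  by (intro CollectI exI[of _ 1]) simp

lemma self_in_left_ideal: "P \<in> {q * P | q. True}" for P :: "'a::monoid_mult"
  by (intro CollectI exI[of _ 1]) simp

text \<open>
  Adding a point \<open>\<alpha>\<close> to \<open>\<Delta>\<close> either leaves \<open>W\<close> unchanged or, if its value \<open>w\<close> at \<open>\<alpha>\<close> is not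
  zero, appends the factor belonging to the conjugate \<open>inverse w * \<alpha> * w\<close>: a multiple
  \<open>W * q\<close> vanishes at \<open>\<alpha>\<close> exactly if \<open>q\<close> has that conjugate as a left root.  The location of
  the right roots is inherited because each linear factor has right roots in a single
  conjugacy class.
\<close>

lemma left_annihilator_generator:
  fixes \<Delta> :: "'a::division_ring set"
  assumes "finite \<Delta>"
  shows "\<exists>W. monic W \<and> left_annihilator \<Delta> = {W * q | q. True} \<and> ncdeg W \<le> card \<Delta> \<and>
    (\<forall>h \<gamma>. h \<noteq> 0 \<longrightarrow> right_eval W h \<gamma> = 0 \<longrightarrow> \<gamma> \<in> conj_closure \<Delta>)"
  using assms
proof (induction \<Delta> rule: finite_induct)
  case empty
  have "ncdeg (1 :: 'a ncpoly) = 0"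
    by (simp add: ncdeg_def)
  moreover have "right_eval 1 h \<gamma> = h" for h \<gamma> :: 'a
    using right_eval_single[of 0 1 h \<gamma>] by simp
  ultimately show ?case
    by (intro exI[of _ 1]) (simp add: monic_def left_annihilator_def)
next
  case (insert \<alpha> \<Delta>)
  then obtain W where W: "monic W" "left_annihilator \<Delta> = {W * q | q. True}"
      "ncdeg W \<le> card \<Delta>"
      "\<And>h \<gamma>. h \<noteq> 0 \<Longrightarrow> right_eval W h \<gamma> = 0 \<Longrightarrow> \<gamma> \<in> conj_closure \<Delta>"
    by blast
  have W_in: "W \<in> left_annihilator \<Delta>"
    unfolding W(2) by (rule self_in_right_ideal)
  define w where "w = left_value W \<alpha>"
  show ?case
  proof (cases "w = 0")
    case True
    have "W * q \<in> left_annihilator (insert \<alpha> \<Delta>)" for q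
      using True W_in
      by (simp add: left_annihilator_def left_value_eq left_eval_mult w_def)
    moreover have "left_annihilator (insert \<alpha> \<Delta>) \<subseteq> left_annihilator \<Delta>"
      by (auto simp: left_annihilator_def)
    ultimately have "left_annihilator (insert \<alpha> \<Delta>) = {W * q | q. True}"
      using W(2) by blast
    moreover have "ncdeg W \<le> card (insert \<alpha> \<Delta>)"
      using W(3) insert.hyps by simp
    ultimately show ?thesis
      using W(1,4) conj_closure_mono[of \<Delta> "insert \<alpha> \<Delta>"] by blast
  next
    case False
    define \<alpha>' where "\<alpha>' = inverse w * \<alpha> * w"
    have comm: "\<alpha> * w = w * \<alpha>'"
      using False by (simp add: \<alpha>'_def mult.assoc[symmetric])
    define V where "V = W * linear_factor \<alpha>'"
    have W0: "W \<noteq> 0" using W(1) by (rule monic_nonzero)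
    have degV: "ncdeg V = ncdeg W + 1"
      using W0 by (simp add: V_def ncdeg_mult linear_factor_props)
    have "monic V"
      using W(1) linear_factor_props(2)[of \<alpha>'] degV lookup_mult_ncdeg[of W "linear_factor \<alpha>'"]
      by (simp add: monic_def V_def linear_factor_props(1))
    moreover have "left_annihilator (insert \<alpha> \<Delta>) = {V * q | q. True}"
    proof (intro equalityI subsetI)
      fix f assume f: "f \<in> left_annihilator (insert \<alpha> \<Delta>)"
      then have "f \<in> left_annihilator \<Delta>" by (simp add: left_annihilator_def)
      then obtain q where q: "f = W * q" unfolding W(2) by blast
      have "left_eval q w \<alpha> = 0"
        using f by (simp add: left_annihilator_def q left_value_eq left_eval_mult w_def)
      then obtain p where "q = linear_factor \<alpha>' * p"
        using left_factor_theorem[OF _ False comm] by blast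
      then show "f \<in> {V * q | q. True}"
        by (auto simp: q V_def mult.assoc)
    next
      fix f assume "f \<in> {V * q | q. True}"
      then obtain q where "f = V * q" by blast
      moreover have "left_eval V 1 \<delta> = 0" if "\<delta> \<in> insert \<alpha> \<Delta>" for \<delta>
        using that W_in comm
        by (auto simp: V_def left_annihilator_def left_value_eq left_eval_mult
            left_eval_linear_factor w_def)
      ultimately show "f \<in> left_annihilator (insert \<alpha> \<Delta>)"
        by (simp add: left_annihilator_def left_value_eq left_eval_mult)
    qed
    moreover have "ncdeg V \<le> card (insert \<alpha> \<Delta>)"
      using W(3) insert.hyps degV by simp
    moreover have "\<gamma> \<in> conj_closure (insert \<alpha> \<Delta>)"
      if "h \<noteq> 0" and root: "right_eval V h \<gamma> = 0" for h \<gamma>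
      \<comment> \<open>The tested expression is the twisted value of the last factor: if it vanishes, \<open>\<gamma>\<close>
        is conjugate to \<open>\<alpha>\<close>; otherwise \<open>\<gamma>\<close> is a root of \<open>W\<close> in the twisted sense.\<close>
    proof (cases "h * \<gamma> - \<alpha>' * h = 0")
      case True
      then have "inverse h * (h * \<gamma>) = inverse h * (\<alpha>' * h)" by simp
      then have "\<gamma> = inverse h * \<alpha>' * h"
        using that(1) by (simp add: mult.assoc[symmetric])
      also have "\<dots> = (inverse h * inverse w) * \<alpha> * inverse (inverse h * inverse w)"
        using that(1) False
        by (simp add: \<alpha>'_def nonzero_inverse_mult_distrib nonzero_imp_inverse_nonzero
            nonzero_inverse_inverse_eq mult.assoc)
      finally have "\<gamma> \<in> conj_class \<alpha>"
        unfolding conj_class_def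
        using that(1) False by (auto simp: nonzero_imp_inverse_nonzero)
      then show ?thesis by (simp add: conj_closure_def)
    next
      case False
      moreover have "right_eval W (h * \<gamma> - \<alpha>' * h) \<gamma> = 0"
        using root by (simp add: V_def right_eval_mult right_eval_linear_factor)
      ultimately show ?thesis
        using W(4) conj_closure_mono[of \<Delta> "insert \<alpha> \<Delta>"] by blast
    qed
    ultimately show ?thesis by blast
  qed
qed

lemma monic_generator_unique:
  fixes P Q :: "'a::division_ring ncpoly"
  assumes "monic P" "monic Q" and eq: "{P * q | q. True} = {Q * q | q. True}"
  shows "P = Q"
proof -
  have nz: "P \<noteq> 0" "Q \<noteq> 0"
    using assms monic_nonzero by auto
  obtain a b where a: "P = Q * a" and b: "Q = P * b"
    using self_in_right_ideal[of P] self_in_right_ideal[of Q] eq by blast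
  have ab: "a \<noteq> 0" "b \<noteq> 0"
    using nz by (auto simp: a) (auto simp: b)
  have "ncdeg P = ncdeg Q + ncdeg a"
    by (subst a) (rule ncdeg_mult[OF nz(2) ab(1)])
  moreover have "ncdeg Q = ncdeg P + ncdeg b"
    by (subst b) (rule ncdeg_mult[OF nz(1) ab(2)])
  ultimately have deg: "ncdeg P = ncdeg Q" by simp
  show ?thesis
  proof (rule ccontr)
    assume "P \<noteq> Q"
    then have "ncdeg (P - Q) < ncdeg P"
      using assms deg by (intro ncdeg_minus_less) (simp_all add: monic_def)
    moreover have "P - Q = P * (1 - b)"
      by (simp add: right_diff_distrib b[symmetric])
    ultimately show False
      using nz \<open>P \<noteq> Q\<close> ncdeg_mult[of P "1 - b"] by force
  qed
qed

lemma left_min_poly_eq: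
  fixes \<Delta> :: "'a::division_ring set"
  assumes "monic W" "left_annihilator \<Delta> = {W * q | q. True}"
  shows "left_min_poly \<Delta> = W"
  unfolding left_min_poly_def
proof (rule the_equality)
  fix P assume "monic P \<and> left_annihilator \<Delta> = {P * q | q. True}"
  then have P: "monic P" "left_annihilator \<Delta> = {P * q | q. True}"
    by (rule conjunct1, rule conjunct2)
  show "P = W"
    by (rule monic_generator_unique[OF P(1) assms(1) trans[OF P(2)[symmetric] assms(2)]])
qed (rule conjI[OF assms])

text \<open>
  For finite \<open>\<Delta>\<close> the generator has the least degree among the nonzero elements of its ideal,
  and this degree never exceeds the number of points; so equality amounts to a lower bound on
  the degrees in the ideal.
\<close>

lemma left_P_independent_iff:
  fixes \<Delta> :: "'a::division_ring set"
  shows "left_P_independent \<Delta> \<longleftrightarrow>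
    finite \<Delta> \<and> (\<forall>f\<in>left_annihilator \<Delta>. f \<noteq> 0 \<longrightarrow> card \<Delta> \<le> ncdeg f)"
proof (cases "finite \<Delta>")
  case True
  then obtain W where W: "monic W" "left_annihilator \<Delta> = {W * q | q. True}" "ncdeg W \<le> card \<Delta>"
    using left_annihilator_generator by metis
  have W0: "W \<noteq> 0" using W(1) by (rule monic_nonzero)
  have W_in: "W \<in> left_annihilator \<Delta>"
    unfolding W(2) by (rule self_in_right_ideal)
  then have "left_algebraic_set \<Delta>"
    using W0 by (auto simp: left_algebraic_set_def)
  then have iff: "left_P_independent \<Delta> \<longleftrightarrow> ncdeg W = card \<Delta>"
    using True by (simp add: left_P_independent_def left_min_poly_eq[OF W(1,2)] set_size_def)
  have "ncdeg W \<le> ncdeg f" if f: "f \<in> left_annihilator \<Delta>" "f \<noteq> 0" for f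
  proof -
    obtain q where "f = W * q" using f(1) unfolding W(2) by blast
    with f(2) W0 show ?thesis by (auto simp: ncdeg_mult)
  qed
  then show ?thesis
    unfolding iff using True W_in W0 W(3) by (auto intro: antisym)
qed (simp add: left_P_independent_def set_size_def)

section \<open>The opposite division ring\<close>

text \<open>
  Reversing the multiplication of the coefficients interchanges left and right evaluation, and
  left and right ideals.  This transports the results on left annihilators to right
  annihilators.
\<close>

datatype 'a opposite = Opp (unopp: 'a)

lemma opposite_eq_iff: "a = b \<longleftrightarrow> unopp a = unopp b"
  by (cases a; cases b) simp

instantiation opposite :: (division_ring) division_ring
begin

definition "0 = Opp 0"
definition "1 = Opp 1"
definition "a + b = Opp (unopp a + unopp b)"
definition "a - b = Opp (unopp a - unopp b)"
definition "- a = Opp (- unopp a)"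
definition "a * b = Opp (unopp b * unopp a)"
definition "inverse a = Opp (inverse (unopp a))"
definition "a div b = a * Opp (inverse (unopp b))"

instance
  by standard
    (auto simp: zero_opposite_def one_opposite_def plus_opposite_def minus_opposite_def
      uminus_opposite_def times_opposite_def inverse_opposite_def divide_opposite_def
      algebra_simps opposite_eq_iff)

end

lemma Opp_power: "Opp a ^ j = Opp ((a :: 'a::division_ring) ^ j)"
  by (induction j) (simp_all add: one_opposite_def times_opposite_def power_commutes)

lemma Opp_eq_0_iff [simp]: "Opp a = 0 \<longleftrightarrow> a = 0"
  by (simp add: zero_opposite_def)

lemma Opp_add: "Opp (a + b) = Opp a + Opp (b :: 'a::division_ring)"
  by (simp add: plus_opposite_def)

lemma Opp_sum: "Opp (\<Sum>j\<in>A. F j) = (\<Sum>j\<in>A. Opp (F j :: 'a::division_ring))"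
  by (induction A rule: infinite_finite_induct) (simp_all add: Opp_add)

definition opp_poly :: "'a::division_ring ncpoly \<Rightarrow> 'a opposite ncpoly"
  where "opp_poly = Poly_Mapping.map Opp"

lemma lookup_opp_poly [simp]: "Poly_Mapping.lookup (opp_poly f) j = Opp (Poly_Mapping.lookup f j)"
  by (simp add: opp_poly_def Poly_Mapping.map.rep_eq when_def zero_opposite_def)

lemma keys_opp_poly [simp]: "Poly_Mapping.keys (opp_poly f) = Poly_Mapping.keys f"
  by (auto simp: in_keys_iff)

lemma ncdeg_opp_poly [simp]: "ncdeg (opp_poly f) = ncdeg f"
  by (simp add: ncdeg_def)

lemma opp_poly_inject: "opp_poly f = opp_poly g \<longleftrightarrow> f = g"
  by (metis lookup_opp_poly opposite.inject poly_mapping_eqI)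

lemma opp_poly_surj: "\<exists>f. g = opp_poly f"
proof
  show "g = opp_poly (Poly_Mapping.map unopp g)"
    by (rule poly_mapping_eqI) (simp add: Poly_Mapping.map.rep_eq when_def)
qed

lemma opp_poly_0_iff [simp]: "opp_poly f = 0 \<longleftrightarrow> f = 0"
  by (auto simp: poly_mapping_eq_iff fun_eq_iff)

lemma monic_opp_poly [simp]: "monic (opp_poly f) \<longleftrightarrow> monic f"
  by (simp add: monic_def one_opposite_def)

lemma opp_poly_add: "opp_poly (f + g) = opp_poly f + opp_poly g"
  by (rule poly_mapping_eqI) (simp add: lookup_add plus_opposite_def)

lemma opp_poly_single: "opp_poly (Poly_Mapping.single j c) = Poly_Mapping.single j (Opp c)"
  by (rule poly_mapping_eqI) (simp add: lookup_single when_def zero_opposite_def)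

lemma opp_poly_mult: "opp_poly (f * g) = opp_poly g * opp_poly f"
proof (induction f rule: ncpoly_induct)
  case (single i a)
  show ?case
    by (induction g rule: ncpoly_induct)
      (simp_all add: mult_single opp_poly_single times_opposite_def add.commute
        distrib_left distrib_right opp_poly_add)
qed (simp add: distrib_left distrib_right opp_poly_add)

lemma left_value_opp_poly: "left_value (opp_poly f) (Opp \<beta>) = Opp (right_value f \<beta>)"
  by (simp add: left_value_def right_value_def Opp_sum Opp_power times_opposite_def)

lemma left_annihilator_Opp: "left_annihilator (Opp ` \<Delta>) = opp_poly ` right_annihilator \<Delta>"
proof (intro equalityI subsetI)
  fix g assume "g \<in> left_annihilator (Opp ` \<Delta>)"
  moreover obtain f where "g = opp_poly f" using opp_poly_surj by blast
  ultimately show "g \<in> opp_poly ` right_annihilator \<Delta>"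
    by (auto simp: left_annihilator_def right_annihilator_def left_value_opp_poly)
qed (auto simp: left_annihilator_def right_annihilator_def left_value_opp_poly)

lemma right_ideal_opp_poly: "{opp_poly P * q | q. True} = opp_poly ` {q * P | q. True}"
proof (intro equalityI subsetI)
  fix g assume "g \<in> {opp_poly P * q | q. True}"
  then obtain q where "g = opp_poly P * q" by blast
  moreover obtain f where "q = opp_poly f" using opp_poly_surj by blast
  ultimately have "g = opp_poly (f * P)" by (simp add: opp_poly_mult)
  then show "g \<in> opp_poly ` {q * P | q. True}" by blast
next
  fix g assume "g \<in> opp_poly ` {q * P | q. True}"
  then obtain f where "g = opp_poly (f * P)" by blast
  then have "g = opp_poly P * opp_poly f" by (simp add: opp_poly_mult)
  then show "g \<in> {opp_poly P * q | q. True}" by blast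
qed

lemma right_generator_iff:
  "right_annihilator \<Delta> = {q * P | q. True} \<longleftrightarrow>
    left_annihilator (Opp ` \<Delta>) = {opp_poly P * q | q. True}"
  unfolding left_annihilator_Opp right_ideal_opp_poly
  by (rule inj_image_eq_iff[symmetric]) (simp add: inj_def opp_poly_inject)

lemma right_annihilator_generator:
  fixes \<Delta> :: "'a::division_ring set"
  assumes "finite \<Delta>"
  shows "\<exists>V. monic V \<and> right_annihilator \<Delta> = {q * V | q. True} \<and> ncdeg V \<le> card \<Delta>"
proof -
  have "finite (Opp ` \<Delta>)" using assms by simp
  then obtain W where "monic W" "left_annihilator (Opp ` \<Delta>) = {W * q | q. True}"
      "ncdeg W \<le> card (Opp ` \<Delta>)"
    using left_annihilator_generator by metis
  moreover obtain V where "W = opp_poly V" using opp_poly_surj by blast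
  moreover have "card (Opp ` \<Delta>) = card \<Delta>"
    by (simp add: card_image inj_on_def)
  ultimately have "monic V" "ncdeg V \<le> card \<Delta>"
      "left_annihilator (Opp ` \<Delta>) = {opp_poly V * q | q. True}"
    by simp_all
  then show ?thesis
    unfolding right_generator_iff by (intro exI[of _ V] conjI)
qed

lemma right_P_independent_iff:
  fixes \<Delta> :: "'a::division_ring set"
  shows "right_P_independent \<Delta> \<longleftrightarrow>
    finite \<Delta> \<and> (\<forall>f\<in>right_annihilator \<Delta>. f \<noteq> 0 \<longrightarrow> card \<Delta> \<le> ncdeg f)"
proof (cases "finite \<Delta>")
  case True
  then obtain V where V: "monic V" "right_annihilator \<Delta> = {q * V | q. True}"
    using right_annihilator_generator[OF True] by blast
  have gen: "left_annihilator (Opp ` \<Delta>) = {opp_poly V * q | q. True}"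
    by (rule right_generator_iff[THEN iffD1, OF V(2)])
  have "right_min_poly \<Delta> = V"
    unfolding right_min_poly_def
  proof (rule the_equality)
    fix P assume "monic P \<and> right_annihilator \<Delta> = {q * P | q. True}"
    then have P: "monic P" "right_annihilator \<Delta> = {q * P | q. True}"
      by (rule conjunct1, rule conjunct2)
    have "{opp_poly P * q | q. True} = {opp_poly V * q | q. True}"
      by (rule trans[OF right_generator_iff[THEN iffD1, OF P(2), symmetric] gen])
    then have "opp_poly P = opp_poly V"
      by (rule monic_generator_unique[rotated 2]) (simp_all add: P(1) V(1))
    then show "P = V" by (simp add: opp_poly_inject)
  qed (rule conjI[OF V])
  moreover have "left_min_poly (Opp ` \<Delta>) = opp_poly V"
    by (rule left_min_poly_eq[OF _ gen]) (simp add: V(1))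
  moreover have card: "card (Opp ` \<Delta>) = card \<Delta>"
    by (simp add: card_image inj_on_def)
  moreover have "right_algebraic_set \<Delta> \<longleftrightarrow> left_algebraic_set (Opp ` \<Delta>)"
    by (auto simp: right_algebraic_set_def left_algebraic_set_def left_annihilator_Opp)
  ultimately have "right_P_independent \<Delta> \<longleftrightarrow> left_P_independent (Opp ` \<Delta>)"
    using True by (simp add: right_P_independent_def left_P_independent_def set_size_def)
  then show ?thesis
    by (simp add: left_P_independent_iff left_annihilator_Opp True card)
qed (simp add: right_P_independent_def set_size_def)

section \<open>Algebraic conjugacy classes\<close>

text \<open>
  A nonzero central polynomial with root \<open>\<alpha>\<close> vanishes on the whole conjugacy class of \<open>\<alpha>\<close>, so
  there is a monic polynomial \<open>\<mu>\<close> of least degree that does.  It is central itself: the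
  commutator of \<open>\<mu>\<close> with a constant vanishes on the class and has smaller degree.  Therefore
  \<open>\<mu>\<close> takes the same left and right value at \<open>\<alpha>\<close>.
\<close>

lemma class_min_poly:
  fixes \<alpha> :: "'a::division_ring"
  assumes "algebraic_over_center \<alpha>"
  shows "\<exists>\<mu>. \<mu> \<noteq> 0 \<and> (\<forall>h. right_eval \<mu> h \<alpha> = 0) \<and> left_value \<mu> \<alpha> = 0 \<and>
    (\<forall>f. f \<noteq> 0 \<longrightarrow> (\<forall>h. right_eval f h \<alpha> = 0) \<longrightarrow> ncdeg \<mu> \<le> ncdeg f)"
proof -
  define I where "I = {f :: 'a ncpoly. \<forall>h. right_eval f h \<alpha> = 0}"
  obtain f0 where f0: "f0 \<noteq> 0" "\<And>j. Poly_Mapping.lookup f0 j \<in> center" "left_value f0 \<alpha> = 0"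
    using assms by (auto simp: algebraic_over_center_def)
  have comm: "Poly_Mapping.lookup f0 j * x = x * Poly_Mapping.lookup f0 j" for j x
    using f0(2)[of j] by (simp add: center_def)
  have "right_eval f0 h \<alpha> = h * left_value f0 \<alpha>" for h
    unfolding right_eval_def left_value_def sum_distrib_left
    by (intro sum.cong refl) (simp only: comm mult.assoc)
  then have "f0 \<in> I" using f0(3) by (simp add: I_def)
  then have "f0 \<in> I \<and> f0 \<noteq> 0" using f0(1) by simp
  then obtain m where m: "m \<in> I" "m \<noteq> 0" and
      least: "\<And>f. f \<in> I \<Longrightarrow> f \<noteq> 0 \<Longrightarrow> ncdeg m \<le> ncdeg f"
    using ex_has_least_nat[of "\<lambda>f. f \<in> I \<and> f \<noteq> 0" f0 ncdeg] by blast
  define l where "l = inverse (Poly_Mapping.lookup m (ncdeg m))"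
  have l: "l \<noteq> 0" using m(2)
    by (simp add: l_def lookup_ncdeg_neq_0 nonzero_imp_inverse_nonzero)
  then have l0: "Poly_Mapping.single 0 l \<noteq> (0 :: 'a ncpoly)"
    by (metis lookup_single_eq lookup_zero)
  define \<mu> where "\<mu> = Poly_Mapping.single 0 l * m"
  have \<mu>0: "\<mu> \<noteq> 0"
    using l0 m(2) by (simp add: \<mu>_def)
  have \<mu>I: "right_eval \<mu> h \<alpha> = 0" for h
    using m(1) by (simp add: I_def \<mu>_def right_eval_mult)
  have deg: "ncdeg \<mu> = ncdeg m"
    using l m(2) l0 by (simp add: \<mu>_def ncdeg_mult ncdeg_single)
  have lead: "Poly_Mapping.lookup \<mu> (ncdeg \<mu>) = 1"
    using m(2) by (simp add: deg) (simp add: \<mu>_def lookup_const_mult l_def lookup_ncdeg_neq_0)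
  have central: "c * Poly_Mapping.lookup \<mu> j = Poly_Mapping.lookup \<mu> j * c" for c j
  proof -
    let ?c = "Poly_Mapping.single 0 c"
    have "?c * \<mu> = \<mu> * ?c"
    proof (rule ccontr)
      assume ne: "?c * \<mu> \<noteq> \<mu> * ?c"
      have "ncdeg (?c * \<mu> - \<mu> * ?c) < ncdeg \<mu>"
      proof (rule ncdeg_minus_less[OF _ _ _ ne])
        have "\<forall>j>ncdeg \<mu>. Poly_Mapping.lookup \<mu> j = 0"
          by (simp flip: ncdeg_le_iff)
        then show "ncdeg (?c * \<mu>) \<le> ncdeg \<mu>" "ncdeg (\<mu> * ?c) \<le> ncdeg \<mu>"
          by (simp_all add: ncdeg_le_iff lookup_const_mult lookup_mult_const)
      qed (simp add: lookup_const_mult lookup_mult_const lead)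
      moreover have "?c * \<mu> - \<mu> * ?c \<in> I"
        using \<mu>I by (simp add: I_def right_eval_diff right_eval_mult)
      ultimately show False
        using least[of "?c * \<mu> - \<mu> * ?c"] ne deg by simp
    qed
    then have "Poly_Mapping.lookup (?c * \<mu>) j = Poly_Mapping.lookup (\<mu> * ?c) j" by simp
    then show ?thesis by (simp add: lookup_const_mult lookup_mult_const)
  qed
  have "left_value \<mu> \<alpha> = right_eval \<mu> 1 \<alpha>"
    by (simp add: left_value_def right_eval_def central)
  with \<mu>0 \<mu>I least deg show ?thesis
    by (intro exI[of _ \<mu>]) (simp add: I_def)
qed

text \<open>
  Both \<open>f\<close> and the minimal polynomial \<open>\<mu>\<close> of the class have the left factor \<open>z - \<alpha>\<close>.  This
  common factor makes room for a common right multiple \<open>f * g = \<mu> * h\<close> with \<open>g\<close> of degree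
  below that of \<open>\<mu>\<close>.  By minimality \<open>g\<close> has a nonzero twisted value \<open>v\<close> at \<open>\<alpha>\<close>, and the
  twisted value of \<open>f\<close> at \<open>v\<close> is one of \<open>\<mu>\<close>, hence zero.
\<close>

lemma left_root_imp_right_root:
  fixes f :: "'a::division_ring ncpoly"
  assumes "algebraic_over_center \<alpha>" "f \<noteq> 0" "left_value f \<alpha> = 0"
  shows "\<exists>h. h \<noteq> 0 \<and> right_eval f h \<alpha> = 0"
proof -
  obtain \<mu> where \<mu>: "\<mu> \<noteq> 0" "\<And>h. right_eval \<mu> h \<alpha> = 0" "left_value \<mu> \<alpha> = 0"
      "\<And>f. f \<noteq> 0 \<Longrightarrow> (\<And>h. right_eval f h \<alpha> = 0) \<Longrightarrow> ncdeg \<mu> \<le> ncdeg f"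
    using class_min_poly[OF assms(1)] by blast
  obtain q where q: "f = linear_factor \<alpha> * q"
    using left_factor_theorem[of f 1 \<alpha> \<alpha>] assms(3) by (auto simp: left_value_eq)
  obtain \<nu> where \<nu>: "\<mu> = linear_factor \<alpha> * \<nu>"
    using left_factor_theorem[of \<mu> 1 \<alpha> \<alpha>] \<mu>(3) by (auto simp: left_value_eq)
  have nz: "q \<noteq> 0" "\<nu> \<noteq> 0" using q \<nu> assms(2) \<mu>(1) by auto
  then obtain g h where gh: "g \<noteq> 0" "q * g = \<nu> * h" "ncdeg g \<le> ncdeg \<nu>"
    using common_right_multiple by blast
  have "ncdeg \<mu> = 1 + ncdeg \<nu>"
    using nz by (simp add: \<nu> ncdeg_mult linear_factor_props)
  with gh obtain k where k: "right_eval g k \<alpha> \<noteq> 0"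
    using \<mu>(4)[of g] by fastforce
  have "f * g = \<mu> * h"
    by (simp add: q \<nu> mult.assoc gh(2))
  then have "right_eval f (right_eval g k \<alpha>) \<alpha> = right_eval \<mu> (right_eval h k \<alpha>) \<alpha>"
    by (simp flip: right_eval_mult)
  with k \<mu>(2) show ?thesis by auto
qed

section \<open>Independent pairs\<close>

lemma conj_closures_meet:
  assumes "\<gamma> \<in> conj_closure A \<inter> conj_closure B"
  shows "\<exists>\<alpha>\<in>A. \<exists>\<beta>\<in>B. \<exists>u. u \<noteq> 0 \<and> \<beta> * u = u * \<alpha>"
proof -
  obtain \<alpha> \<beta> a b where *: "\<alpha> \<in> A" "\<beta> \<in> B" "a \<noteq> 0" "b \<noteq> 0"
      "\<gamma> = a * \<alpha> * inverse a" "\<gamma> = b * \<beta> * inverse b"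
    using assms by (auto simp: conj_closure_def conj_class_def)
  have "inverse b * (\<gamma> * a) = \<beta> * (inverse b * a)"
    using *(4) by (simp add: *(6) mult.assoc[symmetric])
  moreover have "inverse b * (\<gamma> * a) = (inverse b * a) * \<alpha>"
    using *(3) by (simp add: *(5) mult.assoc)
  ultimately have "\<beta> * (inverse b * a) = (inverse b * a) * \<alpha>" by simp
  moreover have "inverse b * a \<noteq> 0"
    using *(3,4) by (simp add: nonzero_imp_inverse_nonzero)
  ultimately show ?thesis
    by (intro bexI[OF _ *(1)] bexI[OF _ *(2)] exI[of _ "inverse b * a"] conjI)
qed

lemma subset_conj_closure: "\<Delta> \<subseteq> conj_closure \<Delta>"
proof
  fix x assume "x \<in> \<Delta>"
  moreover have "x \<in> conj_class x"
    unfolding conj_class_def by (intro CollectI exI[of _ 1]) simp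
  ultimately show "x \<in> conj_closure \<Delta>" by (auto simp: conj_closure_def)
qed

text \<open>
  Under left evaluation the second factor acts on the value of the first, so it preserves a
  zero of the first; under right evaluation the roles are exchanged.
\<close>

lemma mult_in_annihilators:
  assumes "f \<in> left_annihilator A" "g \<in> right_annihilator B"
  shows "f * g \<in> left_annihilator A \<inter> right_annihilator B"
  using assms
  by (simp add: left_annihilator_def right_annihilator_def left_value_eq right_value_eq
      left_eval_mult right_eval_mult)

lemma pair_P_independent_iff:
  "pair_P_independent A B \<longleftrightarrow>
    (\<forall>g\<in>left_annihilator A \<inter> right_annihilator B. g \<noteq> 0 \<longrightarrow>
      set_size A + set_size B \<le> enat (ncdeg g))"
  by (auto simp: pair_P_independent_def left_annihilator_def right_annihilator_def
      polys_below_def not_less)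

text \<open>
  An infinite component would allow every degree, and then a product of two annihilating
  polynomials contradicts independence.
\<close>

lemma pair_P_independent_imp_finite:
  fixes \<Delta>l \<Delta>r :: "'a::division_ring set"
  assumes "left_algebraic_set \<Delta>l" "right_algebraic_set \<Delta>r" "pair_P_independent \<Delta>l \<Delta>r"
  shows "finite \<Delta>l \<and> finite \<Delta>r"
proof -
  obtain f g where "f \<in> left_annihilator \<Delta>l" "f \<noteq> 0" "g \<in> right_annihilator \<Delta>r" "g \<noteq> 0"
    using assms by (auto simp: left_algebraic_set_def right_algebraic_set_def)
  then have "f * g \<in> left_annihilator \<Delta>l \<inter> right_annihilator \<Delta>r" "f * g \<noteq> 0"
    using mult_in_annihilators by auto
  then have "set_size \<Delta>l + set_size \<Delta>r \<le> enat (ncdeg (f * g))"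
    using assms(3) by (auto simp: pair_P_independent_iff)
  then show ?thesis by (auto simp: set_size_def split: if_splits)
qed

text \<open>
  The left generator of \<open>\<Delta>l\<close> has a right root in the class of \<open>\<beta>\<close>.  Hence \<open>\<beta>\<close> can be left
  out when choosing the right-hand factor of the product, provided that a constant between the
  two factors moves the value at \<open>\<beta>\<close> to this root.
\<close>

lemma conjugate_imp_not_pair_P_independent:
  fixes \<Delta>l \<Delta>r :: "'a::division_ring set"
  assumes fin: "finite \<Delta>l" "finite \<Delta>r" and \<alpha>: "\<alpha> \<in> \<Delta>l" "algebraic_over_center \<alpha>"
    and \<beta>: "\<beta> \<in> \<Delta>r" and u: "u \<noteq> 0" "\<beta> * u = u * \<alpha>"
  shows "\<not> pair_P_independent \<Delta>l \<Delta>r"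
proof -
  obtain W where W: "monic W" "left_annihilator \<Delta>l = {W * q | q. True}" "ncdeg W \<le> card \<Delta>l"
    using left_annihilator_generator[OF fin(1)] by metis
  have "W \<in> left_annihilator \<Delta>l"
    unfolding W(2) by (rule self_in_right_ideal)
  obtain V where V: "monic V" "right_annihilator (\<Delta>r - {\<beta>}) = {q * V | q. True}"
      "ncdeg V \<le> card (\<Delta>r - {\<beta>})"
    using right_annihilator_generator[of "\<Delta>r - {\<beta>}"] fin(2) by auto
  have V_in: "V \<in> right_annihilator (\<Delta>r - {\<beta>})"
    unfolding V(2) by (rule self_in_left_ideal)
  have nz: "W \<noteq> 0" "V \<noteq> 0" using W(1) V(1) monic_nonzero by auto
  obtain h where h: "h \<noteq> 0" "right_eval W h \<alpha> = 0"
    using left_root_imp_right_root[OF \<alpha>(2) nz(1)] \<open>W \<in> _\<close> \<alpha>(1)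
    by (auto simp: left_annihilator_def)
  have k: "h * inverse u \<noteq> 0" "right_eval W (h * inverse u) \<beta> = 0"
  proof -
    have "right_eval W (h * inverse u) \<beta> * u = right_eval W h \<alpha>"
      using right_eval_conj[OF u(2), of W "h * inverse u"] u(1) by (simp add: mult.assoc)
    then show "right_eval W (h * inverse u) \<beta> = 0" using h u by simp
  qed (use h u in \<open>simp add: nonzero_imp_inverse_nonzero\<close>)
  \<comment> \<open>Multiplying the value of \<open>V\<close> at \<open>\<beta>\<close> by \<open>c\<close> gives the kernel element just found, unless
    \<open>V\<close> already vanishes at \<open>\<beta>\<close> and any nonzero constant will do.\<close>
  define c where "c = (if right_value V \<beta> = 0 then 1 else h * inverse u * inverse (right_value V \<beta>))"
  have c: "c \<noteq> 0" "right_eval W (c * right_value V \<beta>) \<beta> = 0"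
    using k by (auto simp: c_def mult.assoc nonzero_imp_inverse_nonzero)
  define g where "g = W * (Poly_Mapping.single 0 c * V)"
  have c0: "Poly_Mapping.single 0 c \<noteq> (0 :: 'a ncpoly)"
    using c(1) by (metis lookup_single_eq lookup_zero)
  then have g0: "g \<noteq> 0" using nz by (simp add: g_def)
  have "ncdeg g = ncdeg W + ncdeg V"
    using nz c0 c(1) by (simp add: g_def ncdeg_mult ncdeg_single)
  moreover have "card (\<Delta>r - {\<beta>}) < card \<Delta>r"
    by (rule card_Diff1_less[OF fin(2) \<beta>])
  ultimately have "ncdeg g < card \<Delta>l + card \<Delta>r"
    using W(3) V(3) by linarith
  then have "\<not> set_size \<Delta>l + set_size \<Delta>r \<le> enat (ncdeg g)"
    using fin by (simp add: set_size_def)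
  moreover have "g \<in> left_annihilator \<Delta>l"
    unfolding W(2) g_def by blast
  moreover have "right_value g x = 0" if "x \<in> \<Delta>r" for x
  proof (cases "x = \<beta>")
    case True
    then show ?thesis
      using c(2) by (simp add: g_def right_value_eq right_eval_mult)
  next
    case False
    then have "right_eval V 1 x = 0"
      using that V_in by (simp add: right_annihilator_def right_value_eq)
    then show ?thesis by (simp add: g_def right_value_eq right_eval_mult)
  qed
  ultimately show ?thesis
    using g0 by (auto simp: pair_P_independent_iff right_annihilator_def)
qed

text \<open>
  Cancelling the left generator \<open>W\<close> from \<open>g = W * q\<close> keeps the right zeros in \<open>\<Delta>r\<close>, because
  the right roots of \<open>W\<close> are conjugate to elements of \<open>\<Delta>l\<close>.
\<close>

lemma pair_P_independent_if_disjoint: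
  fixes \<Delta>l \<Delta>r :: "'a::division_ring set"
  assumes "left_P_independent \<Delta>l" "right_P_independent \<Delta>r"
    and disj: "conj_closure \<Delta>l \<inter> conj_closure \<Delta>r = {}"
  shows "pair_P_independent \<Delta>l \<Delta>r"
  unfolding pair_P_independent_iff
proof (intro ballI impI)
  fix g assume g: "g \<in> left_annihilator \<Delta>l \<inter> right_annihilator \<Delta>r" "g \<noteq> 0"
  have fin: "finite \<Delta>l" "finite \<Delta>r"
    and l: "\<And>f. f \<in> left_annihilator \<Delta>l \<Longrightarrow> f \<noteq> 0 \<Longrightarrow> card \<Delta>l \<le> ncdeg f"
    and r: "\<And>f. f \<in> right_annihilator \<Delta>r \<Longrightarrow> f \<noteq> 0 \<Longrightarrow> card \<Delta>r \<le> ncdeg f"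
    using assms(1,2) by (auto simp: left_P_independent_iff right_P_independent_iff)
  obtain W where W: "monic W" "left_annihilator \<Delta>l = {W * q | q. True}"
      "\<And>h \<gamma>. h \<noteq> 0 \<Longrightarrow> right_eval W h \<gamma> = 0 \<Longrightarrow> \<gamma> \<in> conj_closure \<Delta>l"
    using left_annihilator_generator[OF fin(1)] by metis
  have W_in: "W \<in> left_annihilator \<Delta>l"
    unfolding W(2) by (rule self_in_right_ideal)
  obtain q where q: "g = W * q" using g(1) unfolding W(2) by blast
  have nz: "W \<noteq> 0" "q \<noteq> 0" using q g(2) by auto
  have "right_value q \<beta> = 0" if "\<beta> \<in> \<Delta>r" for \<beta>
  proof (rule ccontr)
    assume "right_value q \<beta> \<noteq> 0"
    moreover have "right_eval W (right_value q \<beta>) \<beta> = 0"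
      using g(1) that by (simp add: q right_annihilator_def right_value_eq right_eval_mult)
    ultimately have "\<beta> \<in> conj_closure \<Delta>l" by (rule W(3))
    with that subset_conj_closure disj show False by blast
  qed
  then have "card \<Delta>r \<le> ncdeg q"
    using r nz by (simp add: right_annihilator_def)
  moreover have "card \<Delta>l \<le> ncdeg W" using l W_in nz by blast
  ultimately show "set_size \<Delta>l + set_size \<Delta>r \<le> enat (ncdeg g)"
    using fin nz by (simp add: set_size_def q ncdeg_mult)
qed

text \<open>
  A polynomial of too small degree that annihilates one set, multiplied by the generator for
  the other set, would have degree below \<open>card \<Delta>l + card \<Delta>r\<close>.
\<close>

lemma pair_P_independent_imp_components:
  fixes \<Delta>l \<Delta>r :: "'a::division_ring set"
  assumes fin: "finite \<Delta>l" "finite \<Delta>r" and pair: "pair_P_independent \<Delta>l \<Delta>r"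
  shows "left_P_independent \<Delta>l \<and> right_P_independent \<Delta>r"
proof -
  obtain W where W: "monic W" "left_annihilator \<Delta>l = {W * q | q. True}" "ncdeg W \<le> card \<Delta>l"
    using left_annihilator_generator[OF fin(1)] by metis
  obtain V where V: "monic V" "right_annihilator \<Delta>r = {q * V | q. True}" "ncdeg V \<le> card \<Delta>r"
    using right_annihilator_generator[OF fin(2)] by metis
  have W_in: "W \<in> left_annihilator \<Delta>l"
    unfolding W(2) by (rule self_in_right_ideal)
  have V_in: "V \<in> right_annihilator \<Delta>r"
    unfolding V(2) by (rule self_in_left_ideal)
  have nz: "W \<noteq> 0" "V \<noteq> 0" using W(1) V(1) monic_nonzero by auto
  have bound: "card \<Delta>l + card \<Delta>r \<le> ncdeg f + ncdeg g"
    if "f \<in> left_annihilator \<Delta>l" "g \<in> right_annihilator \<Delta>r" "f \<noteq> 0" "g \<noteq> 0" for f g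
  proof -
    have "set_size \<Delta>l + set_size \<Delta>r \<le> enat (ncdeg (f * g))"
      using pair that mult_in_annihilators[of f \<Delta>l g \<Delta>r]
      by (simp add: pair_P_independent_iff)
    then show ?thesis using fin that by (simp add: set_size_def ncdeg_mult)
  qed
  have "card \<Delta>l \<le> ncdeg f" if "f \<in> left_annihilator \<Delta>l" "f \<noteq> 0" for f
    using bound[OF that(1) V_in that(2) nz(2)] V(3) by simp
  moreover have "card \<Delta>r \<le> ncdeg g" if "g \<in> right_annihilator \<Delta>r" "g \<noteq> 0" for g
    using bound[OF W_in that(1) nz(1) that(2)] W(3) by simp
  ultimately show ?thesis
    using fin by (simp add: left_P_independent_iff right_P_independent_iff)
qed

theorem proposition3p12:
  fixes \<Delta>l \<Delta>r :: "'a::division_ring set"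
  assumes "left_algebraic_set \<Delta>l"
    and "right_algebraic_set \<Delta>r"
    and "\<And>\<alpha>. \<alpha> \<in> \<Delta>l \<Longrightarrow> algebraic_over_center \<alpha>"
  shows "pair_P_independent \<Delta>l \<Delta>r \<longleftrightarrow>
    left_P_independent \<Delta>l \<and> right_P_independent \<Delta>r \<and>
    conj_closure \<Delta>l \<inter> conj_closure \<Delta>r = {}"
proof
  assume pair: "pair_P_independent \<Delta>l \<Delta>r"
  then have fin: "finite \<Delta>l" "finite \<Delta>r"
    using assms(1,2) pair_P_independent_imp_finite by auto
  have "conj_closure \<Delta>l \<inter> conj_closure \<Delta>r = {}"
  proof (rule equals0I)
    fix \<gamma> assume "\<gamma> \<in> conj_closure \<Delta>l \<inter> conj_closure \<Delta>r"
    then obtain \<alpha> \<beta> u where "\<alpha> \<in> \<Delta>l" "\<beta> \<in> \<Delta>r" "u \<noteq> 0" "\<beta> * u = u * \<alpha>"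
      using conj_closures_meet by metis
    then show False
      using conjugate_imp_not_pair_P_independent[OF fin] assms(3) pair by metis
  qed
  with pair_P_independent_imp_components[OF fin pair]
  show "left_P_independent \<Delta>l \<and> right_P_independent \<Delta>r \<and>
    conj_closure \<Delta>l \<inter> conj_closure \<Delta>r = {}" by blast
qed (auto intro: pair_P_independent_if_disjoint)

end
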